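(* Let $f$ be a transcendental entire function with finitely many zeroes in the complex plane, and let $p$ be a non-constant polynomial with complex coefficients. (A) If $f$ is neither even nor odd, then $p\circ f$ is not even. (B) If $f$ is not odd, then $p\circ f$ is not odd.
   Context: A function $h$ is even if $h(-z)=h(z)$ for all $z$, and odd if $h(-z)=-h(z)$ for all $z$. An entire function is transcendental if it is not a polynomial. *)

theory Defs
  imports "HOL-Complex_Analysis.Complex_Analysis"
    "HOL-Computational_Algebra.Polynomial"
begin

definition even_function :: "(complex \<Rightarrow> complex) \<Rightarrow> bool" where
  "even_function h \<longleftrightarrow> (\<forall>z. h (- z) = h z)"

definition odd_function :: "(complex \<Rightarrow> complex) \<Rightarrow> bool" where
  "odd_function h \<longleftrightarrow> (\<forall>z. h (- z) = - h z)"

definition entire :: "(complex \<Rightarrow> complex) \<Rightarrow> bool" where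
  "entire f \<longleftrightarrow> f holomorphic_on UNIV"

definition transcendental_entire :: "(complex \<Rightarrow> complex) \<Rightarrow> bool" where
  "transcendental_entire f \<longleftrightarrow> entire f \<and> \<not> (\<exists>q :: complex poly. f = poly q)"

end

theory Submission imports Defs "HOL-Real_Asymp.Real_Asymp"
begin

text \<open>Write \<open>f = R * exp g\<close> with \<open>R\<close> a polynomial, and let \<open>a\<close>, \<open>b\<close> be the logarithmic derivatives of
  \<open>f(z)\<close> and \<open>f(-z)\<close>. If \<open>p(f(z)) = p(f(-z))\<close>, then differentiating shows that where \<open>f\<close> is large the
  numbers \<open>a\<close> and \<open>b\<close> agree up to a factor \<open>1 + O(1/f)\<close>, so \<open>f * (a - b)\<close> is bounded by a multiple of
  \<open>norm a + norm b\<close>, a quantity controlled by \<open>deriv g\<close>. If \<open>a - b\<close> does not vanish identically, then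
  \<open>exp g\<close> is a quotient of two functions of the size of \<open>deriv g\<close>, hence \<open>Re g\<close> grows at most like
  the logarithm of \<open>g\<close>, which is impossible for nonconstant \<open>g\<close>. So \<open>a = b\<close>, whence
  \<open>f(-z) = c * f(z)\<close> with \<open>c\<^sup>2 = 1\<close>. The odd case reduces to this by passing from \<open>p\<close> to \<open>p\<^sup>2\<close>.\<close>

subsection \<open>Bounded quotients of entire functions\<close>

text \<open>Near \<open>a\<close> the local factor given by the zero order is used, elsewhere the
  plain quotient; the two agree on the overlap and glue to an entire function. The point
  \<open>w0\<close> makes the order at \<open>a\<close> finite.\<close>

lemma entire_factor_at:
  assumes f: "f holomorphic_on UNIV" and nz: "f w0 \<noteq> 0"
  obtains n h where "h holomorphic_on UNIV" "h a \<noteq> 0" "\<And>z. f z = (z - a) ^ n * h z"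
proof -
  define N where "N = nat (zorder f a)"
  define g where "g = zor_poly f a"
  obtain r where r: "r > 0" "g holomorphic_on cball a r"
    "\<And>w. w \<in> cball a r \<Longrightarrow> f w = g w * (w - a) ^ N" "\<And>w. w \<in> cball a r \<Longrightarrow> g w \<noteq> 0"
    using zorder_exist_zero[of f UNIV a, folded N_def g_def] f nz by (meson UNIV_I connected_UNIV open_UNIV)
  define h where "h w = (if w = a then g a else f w / (w - a) ^ N)" for w
  have hg: "h w = g w" if "w \<in> ball a r" for w
    using r(3)[of w] that by (auto simp: h_def)
  have "h holomorphic_on ball a r"
    using holomorphic_on_subset[OF r(2) ball_subset_cball]
    by (rule holomorphic_transform) (simp add: hg)
  moreover have "h holomorphic_on - {a}"
  proof (rule holomorphic_transform)
    show "(\<lambda>w. f w / (w - a) ^ N) holomorphic_on - {a}"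
      by (intro holomorphic_intros holomorphic_on_subset[OF f]) auto
  qed (auto simp: h_def)
  ultimately have "h holomorphic_on (ball a r \<union> - {a})"
    by (intro holomorphic_on_Un) auto
  moreover have "ball a r \<union> - {a} = UNIV"
    using r(1) by auto
  moreover have "f z = (z - a) ^ N * h z" for z
    using r(3)[of a] r(1) by (auto simp: h_def)
  moreover have "h a \<noteq> 0"
    using r(4)[of a] r(1) by (simp add: h_def)
  ultimately show thesis
    using that by metis
qed

text \<open>Divides out the points of \<open>Z\<close> one at a time. If \<open>Z\<close> contains
  all zeros of \<open>f\<close> in a region, the cofactor is zero-free there and so may be written
  as an exponential.\<close>

lemma entire_factor_finite:
  assumes f: "f holomorphic_on UNIV" and nz: "f w0 \<noteq> 0" and "finite Z"
  shows "\<exists>m h. h holomorphic_on UNIV \<and> (\<forall>a\<in>Z. h a \<noteq> 0) \<and>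
           (\<forall>z. f z = (\<Prod>a\<in>Z. (z - a) ^ m a) * h z)"
  using \<open>finite Z\<close>
proof (induction Z)
  case empty
  then show ?case using f by auto
next
  case (insert b Z)
  then obtain m h where h: "h holomorphic_on UNIV" "\<forall>a\<in>Z. h a \<noteq> 0"
    "\<And>z. f z = (\<Prod>a\<in>Z. (z - a) ^ m a) * h z"
    by auto
  have "h w0 \<noteq> 0"
    using h(3)[of w0] nz by auto
  then obtain n k where k: "k holomorphic_on UNIV" "k b \<noteq> 0" "\<And>z. h z = (z - b) ^ n * k z"
    using entire_factor_at[OF h(1)] by metis
  have "(\<Prod>a\<in>insert b Z. (z - a) ^ (m(b := n)) a) = (z - b) ^ n * (\<Prod>a\<in>Z. (z - a) ^ m a)" for z
  proof -
    have "(\<Prod>a\<in>Z. (z - a) ^ (m(b := n)) a) = (\<Prod>a\<in>Z. (z - a) ^ m a)"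
      using insert.hyps by (intro prod.cong) auto
    then show ?thesis
      using insert.hyps by simp
  qed
  moreover have "\<forall>a\<in>insert b Z. k a \<noteq> 0"
    using k h(2) by auto
  ultimately show ?case
    using k h(3) by (intro exI[of _ "m(b := n)"] exI[of _ k]) auto
qed

text \<open>A one-sided bound on the real part places \<open>f - f 0\<close> in a half-plane; a
  Moebius map to the unit disc fixing 0 reduces the estimate to the Schwarz lemma.\<close>

lemma Borel_Caratheodory:
  fixes f :: "complex \<Rightarrow> complex"
  assumes f: "f holomorphic_on ball 0 R" and le: "\<And>z. norm z < R \<Longrightarrow> Re (f z) \<le> A"
    and z: "norm z < R"
  shows "norm (f z - f 0) \<le> 2 * norm z / (R - norm z) * (A - Re (f 0))"
proof -
  have R: "R > 0"
    using z norm_ge_zero[of z] by linarith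
  \<comment> \<open>A strictly larger \<open>B\<close> ensures \<open>B > 0\<close> and keeps the
    Moebius denominator away from 0, even for constant \<open>f\<close>. At the end \<open>B\<close>
    decreases to \<open>A - Re (f 0)\<close>.\<close>
  have *: "norm (f z - f 0) \<le> 2 * norm z / (R - norm z) * B" if B: "B > A - Re (f 0)" for B
  proof -
    define \<psi> where "\<psi> w = f w - f 0" for w
    \<comment> \<open>The point \<open>2 * B\<close> is the mirror image of 0 in the line
      \<open>Re u = B\<close>, so \<open>u / (2 * B - u)\<close> has modulus below 1 exactly when
      \<open>Re u < B\<close>.\<close>
    define \<Phi> where "\<Phi> w = \<psi> (of_real R * w) / (2 * of_real B - \<psi> (of_real R * w))" for w
    have in_ball: "norm (of_real R * w) < R" if "norm w < 1" for w :: complex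
      using that R by (simp add: norm_mult)
    have Re_less: "Re (\<psi> w) < B" if "norm w < R" for w
      using le[OF that] B by (simp add: \<psi>_def)
    have B0: "B > 0"
      using Re_less[of 0] R by (simp add: \<psi>_def)
    have less: "norm (\<psi> w) < norm (2 * of_real B - \<psi> w)" if "norm w < R" for w
    proof -
      have "(Re (\<psi> w))\<^sup>2 < (2 * B - Re (\<psi> w))\<^sup>2"
      proof -
        have "(2 * B - Re (\<psi> w))\<^sup>2 - (Re (\<psi> w))\<^sup>2 = 4 * B * (B - Re (\<psi> w))"
          by (simp add: power2_eq_square algebra_simps)
        moreover have "4 * B * (B - Re (\<psi> w)) > 0"
          using B0 Re_less[OF that] by simp
        ultimately show ?thesis by linarith
      qed
      then have "(norm (\<psi> w))\<^sup>2 < (norm (2 * of_real B - \<psi> w))\<^sup>2"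
        by (simp add: cmod_power2)
      then show ?thesis
        using power_less_imp_less_base norm_ge_zero by blast
    qed
    have "\<Phi> holomorphic_on ball 0 1"
    proof -
      have "(\<lambda>w. f (of_real R * w)) holomorphic_on ball 0 1"
        using in_ball
        by (intro holomorphic_on_compose_gen[OF _ f, unfolded o_def] holomorphic_intros) auto
      moreover have "2 * of_real B - \<psi> (of_real R * w) \<noteq> 0" if "w \<in> ball 0 1" for w
        using less[of "of_real R * w"] in_ball[of w] that by auto
      ultimately show ?thesis
        unfolding \<Phi>_def \<psi>_def by (intro holomorphic_intros) auto
    qed
    moreover have "norm (\<Phi> w) < 1" if "norm w < 1" for w
      using less[OF in_ball[OF that]] le_less_trans[OF norm_ge_zero less[OF in_ball[OF that]]]
      by (simp add: \<Phi>_def norm_divide divide_simps)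
    moreover have "\<Phi> 0 = 0"
      by (simp add: \<Phi>_def \<psi>_def)
    moreover have "norm (z / of_real R) < 1"
      using z R by (simp add: norm_divide)
    ultimately have "norm (\<Phi> (z / of_real R)) \<le> norm (z / of_real R)"
      using Schwarz_Lemma(1) by blast
    then have "norm (\<psi> z) * R \<le> norm z * norm (2 * of_real B - \<psi> z)"
      using R less[OF z] le_less_trans[OF norm_ge_zero less[OF z]]
      by (simp add: \<Phi>_def norm_divide divide_simps mult.commute)
    also have "\<dots> \<le> norm z * (2 * B + norm (\<psi> z))"
      using norm_triangle_ineq4[of "2 * of_real B" "\<psi> z"] B0
      by (intro mult_left_mono) (auto simp: norm_mult)
    finally have "norm (\<psi> z) * (R - norm z) \<le> 2 * norm z * B"
      by (simp add: algebra_simps)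
    then show ?thesis
      using z by (simp add: \<psi>_def field_simps)
  qed
  have "((\<lambda>B. 2 * norm z / (R - norm z) * B) \<longlongrightarrow> 2 * norm z / (R - norm z) * (A - Re (f 0)))
          (at_right (A - Re (f 0)))"
    by (intro tendsto_intros)
  moreover have "eventually (\<lambda>B. norm (f z - f 0) \<le> 2 * norm z / (R - norm z) * B)
          (at_right (A - Re (f 0)))"
    by (rule eventually_mono[OF eventually_at_right_less]) (use * in auto)
  ultimately show ?thesis
    by (rule tendsto_lowerbound) auto
qed

lemma entire_norm_le_on_cball:
  assumes f: "f holomorphic_on UNIV" and "\<And>z. norm z = R \<Longrightarrow> norm (f z) \<le> M" and "norm w \<le> R"
  shows "norm (f w) \<le> M"
proof (cases "R = 0")
  case False
  then have "R > 0" using assms(3) norm_ge_zero[of w] by linarith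
  show ?thesis
  proof (rule maximum_modulus_frontier[of f "cball 0 R"])
    show "continuous_on (closure (cball 0 R)) f"
      by (rule holomorphic_on_imp_continuous_on[OF holomorphic_on_subset[OF f]]) auto
  qed (use assms \<open>R > 0\<close> in \<open>auto intro: holomorphic_on_subset[OF f]\<close>)
qed (use assms in auto)

text \<open>Replacing the zeros of \<open>D\<close> in the disc by Blaschke factors leaves \<open>norm D\<close> unchanged on the
  boundary circle and makes \<open>D\<close> the exponential of a function to which Borel-Caratheodory applies.\<close>

lemma Re_le_of_bounded_quotient:
  fixes D g :: "complex \<Rightarrow> complex"
  assumes D: "D holomorphic_on UNIV" and g: "g holomorphic_on UNIV" and D0: "D 0 \<noteq> 0"
    and MD: "\<And>z. norm z = R \<Longrightarrow> norm (D z) \<le> M"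
    and MK: "\<And>z. norm z = R \<Longrightarrow> norm (exp (g z) * D z) \<le> M"
    and w: "norm w < R"
  shows "Re (g w) \<le> (R + norm w) / (R - norm w) * (ln M - ln (norm (D 0)))"
proof -
  have R: "R > 0"
    using w norm_ge_zero[of w] by linarith
  have M: "M > 0"
  proof -
    have "norm (D 0) \<le> M"
      using R by (intro entire_norm_le_on_cball[OF D MD]) auto
    then show ?thesis
      using D0 by (smt (verit) zero_less_norm_iff)
  qed
  define Z where "Z = {z \<in> ball 0 R. D z = 0}"
  have "finite Z"
  proof (cases "D constant_on UNIV")
    case True
    then show ?thesis using D0 by (auto simp: Z_def constant_on_def)
  next
    case False
    then have "finite {z \<in> cball 0 R. D z = 0}"
      using D by (intro holomorphic_compact_finite_zeros[of D UNIV]) auto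
    then show ?thesis
      by (rule rev_finite_subset) (auto simp: Z_def)
  qed
  then obtain m h where h: "h holomorphic_on UNIV" "\<And>a. a \<in> Z \<Longrightarrow> h a \<noteq> 0"
    "\<And>z. D z = (\<Prod>a\<in>Z. (z - a) ^ m a) * h z"
    using entire_factor_finite[OF D D0] by metis
  \<comment> \<open>The replacement for \<open>z - a\<close> vanishes only at
    \<open>R ^ 2 / cnj a\<close>, which lies outside the disc (and nowhere if
    \<open>a = 0\<close>).\<close>
  define E where "E z = (\<Prod>a\<in>Z. ((of_real R ^ 2 - cnj a * z) / of_real R) ^ m a) * h z" for z
  have E: "E holomorphic_on UNIV"
    unfolding E_def using R by (intro holomorphic_intros h) auto
  have E_circle: "norm (E z) = norm (D z)" if z: "norm z = R" for z
  proof -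
    have "norm ((of_real R ^ 2 - cnj a * z) / of_real R) = norm (z - a)" for a
    proof -
      have "of_real R ^ 2 = z * cnj z"
        using z by (simp add: complex_norm_square[symmetric])
      then have "of_real R ^ 2 - cnj a * z = z * cnj (z - a)"
        by (simp add: algebra_simps)
      then have "norm (of_real R ^ 2 - cnj a * z) = R * norm (z - a)"
        using z by (simp only: norm_mult complex_mod_cnj)
      then show ?thesis
        using R by (simp add: norm_divide)
    qed
    then show ?thesis
      by (simp add: E_def h(3) norm_mult norm_power flip: prod_norm)
  qed
  have E_nz: "E z \<noteq> 0" if z: "norm z < R" for z
  proof -
    have "h z \<noteq> 0"
    proof
      assume "h z = 0"
      then have "z \<in> Z" using h(3)[of z] z by (simp add: Z_def)
      then show False using h(2) \<open>h z = 0\<close> by blast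
    qed
    moreover have "of_real R ^ 2 - cnj a * z \<noteq> 0" if "a \<in> Z" for a
    proof
      assume "of_real R ^ 2 - cnj a * z = 0"
      then have "norm (of_real R ^ 2 :: complex) = norm (cnj a * z)"
        by simp
      then have "R * R = norm a * norm z"
        by (simp add: norm_mult norm_power power2_eq_square)
      moreover have "norm a * norm z < R * R"
        using that z R by (intro mult_strict_mono') (auto simp: Z_def)
      ultimately show False by simp
    qed
    ultimately show ?thesis
      using R \<open>finite Z\<close> by (auto simp: E_def)
  qed
  \<comment> \<open>At the origin a factor of modulus \<open>norm a < R\<close> is exchanged for one
    of modulus \<open>R\<close>.\<close>
  have E0: "norm (D 0) \<le> norm (E 0)"
  proof -
    have "(\<Prod>a\<in>Z. norm ((0 - a) ^ m a)) \<le> (\<Prod>a\<in>Z. norm ((of_real R :: complex) ^ m a))"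
      using R by (intro prod_mono) (auto simp: Z_def norm_power intro!: power_mono)
    then show ?thesis
      using R by (simp add: E_def h(3) norm_mult power2_eq_square mult_right_mono flip: prod_norm)
  qed
  obtain k where k: "k holomorphic_on ball 0 R" "\<And>z. z \<in> ball 0 R \<Longrightarrow> E z = exp (k z)"
    using contractible_imp_holomorphic_log[of E "ball 0 R"] E E_nz
    by (metis convex_ball convex_imp_contractible holomorphic_on_subset mem_ball_0 top_greatest)
  have E_le: "norm (E z) \<le> M" if "norm z \<le> R" for z
    using entire_norm_le_on_cball[OF E _ that] E_circle MD by simp
  have gE_le: "norm (exp (g z) * E z) \<le> M" if "norm z \<le> R" for z
  proof (rule entire_norm_le_on_cball[OF _ _ that])
    show "(\<lambda>z. exp (g z) * E z) holomorphic_on UNIV"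
      by (intro holomorphic_intros E g)
  qed (use E_circle MK in \<open>simp add: norm_mult\<close>)
  have Re_k: "Re (k z) \<le> ln M" if "norm z < R" for z
    using E_le[of z] k(2)[of z] that M by (simp add: ln_ge_iff)
  have k0: "ln (norm (D 0)) \<le> Re (k 0)"
    using ln_mono[OF E0] k(2)[of 0] R D0 by simp
  have gk: "Re (g w) + Re (k w) \<le> ln M"
    using gE_le[of w] k(2)[of w] w M by (simp add: norm_mult ln_ge_iff flip: exp_add)
  \<comment> \<open>The upper bound \<open>ln M\<close> on \<open>Re k\<close> yields a lower bound
    on \<open>Re (k w)\<close>, which \<open>gk\<close> turns into an upper bound on
    \<open>Re (g w)\<close>.\<close>
  have "Re (k 0) - Re (k w) \<le> 2 * norm w / (R - norm w) * (ln M - Re (k 0))"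
    using Borel_Caratheodory[OF k(1) Re_k w] abs_Re_le_cmod[of "k w - k 0"] by auto
  then have "Re (g w) \<le> (1 + 2 * norm w / (R - norm w)) * (ln M - Re (k 0))"
    using gk by (simp add: algebra_simps)
  also have "1 + 2 * norm w / (R - norm w) = (R + norm w) / (R - norm w)"
    using w by (simp add: field_simps)
  also have "\<dots> * (ln M - Re (k 0)) \<le> \<dots> * (ln M - ln (norm (D 0)))"
    using k0 w R by (intro mult_left_mono) auto
  finally show ?thesis .
qed

subsection \<open>Pairs of points with equal polynomial value\<close>

lemma poly_norm_upper_bound:
  fixes q :: "'a::real_normed_field poly"
  assumes "degree q \<le> k"
  obtains C where "C > 0" "\<And>x. norm (poly q x) \<le> C * (1 + norm x) ^ k"
proof
  define C where "C = 1 + (\<Sum>i\<le>degree q. norm (coeff q i))"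
  show "C > 0"
    unfolding C_def by (simp add: add_pos_nonneg sum_nonneg)
  show "norm (poly q x) \<le> C * (1 + norm x) ^ k" for x
  proof -
    have "norm (poly q x) \<le> (\<Sum>i\<le>degree q. norm (coeff q i) * norm x ^ i)"
      unfolding poly_altdef by (rule norm_sum[THEN order_trans]) (simp add: norm_mult norm_power)
    also have "\<dots> \<le> (\<Sum>i\<le>degree q. norm (coeff q i) * (1 + norm x) ^ k)"
    proof (intro sum_mono mult_left_mono)
      fix i assume "i \<in> {..degree q}"
      then have "norm x ^ i \<le> (1 + norm x) ^ i" "(1 + norm x) ^ i \<le> (1 + norm x) ^ k"
        using assms by (auto intro: power_mono power_increasing)
      then show "norm x ^ i \<le> (1 + norm x) ^ k" by linarith
    qed auto
    also have "\<dots> \<le> C * (1 + norm x) ^ k"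
      by (simp add: C_def sum_distrib_right[symmetric] mult_right_mono)
    finally show ?thesis .
  qed
qed

lemma poly_norm_lower_bound:
  fixes q :: "complex poly"
  assumes "q \<noteq> 0"
  obtains c T where "c > 0" "T \<ge> 1" "\<And>x. norm x \<ge> T \<Longrightarrow> norm (poly q x) \<ge> c * norm x ^ degree q"
proof (cases "degree q")
  case 0
  then obtain a where "q = [:a:]"
    by (auto elim: degree_eq_zeroE)
  then show thesis
    using assms by (intro that[of "norm a" 1]) auto
next
  case (Suc n)
  define l where "l = norm (lead_coeff q)"
  have l: "l > 0"
    using assms by (simp add: l_def)
  \<comment> \<open>Far out the lower-order terms are at most half of the leading term.\<close>
  obtain T where T: "\<And>x. T \<le> norm x \<Longrightarrow> norm (\<Sum>i\<le>n. coeff q i * x ^ i) \<le> l / 2 * norm x ^ Suc n"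
    using polyfun_extremal_lemma[of "l / 2" "coeff q" n] l by auto
  show thesis
  proof (rule that[of "l / 2" "max 1 T"])
    fix x :: complex assume x: "norm x \<ge> max 1 T"
    have "poly q x = (\<Sum>i\<le>n. coeff q i * x ^ i) + lead_coeff q * x ^ Suc n"
      by (simp add: poly_altdef Suc)
    then have "norm (poly q x) \<ge> l * norm x ^ Suc n - norm (\<Sum>i\<le>n. coeff q i * x ^ i)"
      using norm_diff_ineq[of "lead_coeff q * x ^ Suc n" "\<Sum>i\<le>n. coeff q i * x ^ i"]
      by (simp add: l_def norm_mult norm_power add.commute)
    then show "l / 2 * norm x ^ degree q \<le> norm (poly q x)"
      using T[of x] x by (simp add: Suc)
  qed (use l in auto)
qed

text \<open>Since \<open>x * p'(x) - n * p(x)\<close> has degree below \<open>n\<close>, the equation \<open>p(x) = p(y)\<close> forces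
  \<open>x * p'(x)\<close> and \<open>y * p'(y)\<close> to differ by only \<open>O(norm x ^ (n - 1))\<close>.\<close>

lemma poly_eq_imp_weights_close:
  fixes p :: "complex poly"
  assumes "degree p > 0"
  obtains C where "C > 0"
    "\<And>x y a b. poly p x = poly p y \<Longrightarrow>
       x * poly (pderiv p) x * a = y * poly (pderiv p) y * b \<Longrightarrow>
       norm x * norm (a - b) \<le> C * (norm a + norm b)"
proof -
  define n where "n = degree p"
  have n: "n > 0" using assms by (simp add: n_def)
  define P where "P = pCons 0 (pderiv p)"
  have P: "poly P x = x * poly (pderiv p) x" for x
    by (simp add: P_def)
  have pd: "pderiv p \<noteq> 0"
    using assms by (simp add: pderiv_eq_0_iff)
  have degP: "degree P = n"
    using assms pd by (simp add: P_def degree_pderiv n_def)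
  have "P \<noteq> 0" using degP n by auto
  define q where "q = P - smult (of_nat n) p"
  have degq: "degree q \<le> n - 1"
  proof (rule degree_le, intro allI impI)
    fix i assume "i > n - 1"
    then consider "i = n" | "i > n" using n by linarith
    then show "coeff q i = 0"
    proof cases
      case 1
      then obtain j where "n = Suc j" using n gr0_implies_Suc by blast
      then show ?thesis
        using 1 by (simp add: q_def P_def coeff_pderiv)
    next
      case 2
      then show ?thesis
        using degP by (simp add: q_def coeff_eq_0 n_def)
    qed
  qed
  obtain Cq where Cq: "Cq > 0" "\<And>x. norm (poly q x) \<le> Cq * (1 + norm x) ^ (n - 1)"
    using poly_norm_upper_bound[OF degq] by metis
  obtain Cp where Cp: "Cp > 0" "\<And>x. norm (poly p x) \<le> Cp * (1 + norm x) ^ n"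
    using poly_norm_upper_bound[of p n] n_def by auto
  obtain c1 T1 where c1: "c1 > 0" "T1 \<ge> 1" "\<And>x. norm x \<ge> T1 \<Longrightarrow> norm (poly p x) \<ge> c1 * norm x ^ n"
    using poly_norm_lower_bound[of p] assms n_def by (metis degree_0 less_irrefl)
  obtain c2 T2 where c2: "c2 > 0" "T2 \<ge> 1" "\<And>x. norm x \<ge> T2 \<Longrightarrow> norm (poly P x) \<ge> c2 * norm x ^ n"
    using poly_norm_lower_bound[OF \<open>P \<noteq> 0\<close>] degP by metis
  define T where "T = max T1 T2"
  \<comment> \<open>If \<open>norm y > K * norm x\<close>, the lower bound for \<open>p\<close> at
    \<open>y\<close> would exceed the upper bound for \<open>p\<close> at \<open>x\<close>. In
    \<open>C\<close>, the entry \<open>T\<close> serves small \<open>x\<close> and the other one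
    large \<open>x\<close>.\<close>
  define K where "K = max 1 (Cp * 2 ^ n / c1)"
  define C where "C = max T (Cq * (2 ^ (n - 1) + (1 + K) ^ (n - 1)) / c2)"
  have T: "T \<ge> 1" "T \<ge> T1" "T \<ge> T2" using c1 by (auto simp: T_def)
  have K: "K \<ge> 1" "Cp * 2 ^ n \<le> K * c1"
    using c1(1) by (auto simp: K_def pos_divide_le_eq[symmetric])
  show thesis
  proof (rule that[of C])
    show "C > 0" using T by (auto simp: C_def)
    fix x y a b :: complex
    assume pxy: "poly p x = poly p y"
      and weights: "x * poly (pderiv p) x * a = y * poly (pderiv p) y * b"
    show "norm x * norm (a - b) \<le> C * (norm a + norm b)"
    proof (cases "norm x < T")
      case True
      have "norm x * norm (a - b) \<le> T * (norm a + norm b)"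
        using True T norm_triangle_ineq4[of a b] by (intro mult_mono) auto
      also have "\<dots> \<le> C * (norm a + norm b)"
        by (intro mult_right_mono) (auto simp: C_def)
      finally show ?thesis .
    next
      case False
      then have x: "norm x \<ge> T" by simp
      have x1: "1 + norm x \<le> 2 * norm x" using x T by simp
      have y: "norm y \<le> K * norm x"
      proof (rule ccontr)
        assume "\<not> norm y \<le> K * norm x"
        then have ly: "norm y > K * norm x" by simp
        moreover have "K * norm x \<ge> 1 * norm x" using K by (intro mult_right_mono) auto
        ultimately have "norm y \<ge> T1" using x T by linarith
        then have "c1 * norm y ^ n \<le> norm (poly p x)"
          using c1(3) pxy by simp
        also have "\<dots> \<le> Cp * (2 * norm x) ^ n"
          using Cp x1 by (intro order_trans[OF Cp(2)] mult_left_mono power_mono) auto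
        also have "\<dots> = Cp * 2 ^ n * norm x ^ n"
          by (simp add: power_mult_distrib)
        also have "\<dots> \<le> K * c1 * norm x ^ n"
          using K by (intro mult_right_mono) auto
        also have "\<dots> \<le> K ^ n * c1 * norm x ^ n"
          using K c1 n by (intro mult_right_mono self_le_power) auto
        also have "\<dots> = c1 * (K * norm x) ^ n"
          by (simp add: power_mult_distrib)
        also have "\<dots> < c1 * norm y ^ n"
          using ly n c1 K by (intro mult_strict_left_mono power_strict_mono) auto
        finally show False by simp
      qed
      have qx: "norm (poly q x) \<le> Cq * 2 ^ (n - 1) * norm x ^ (n - 1)"
      proof -
        have "Cq * (1 + norm x) ^ (n - 1) \<le> Cq * (2 * norm x) ^ (n - 1)"
          using Cq x1 by (intro mult_left_mono power_mono) auto
        then show ?thesis using Cq(2)[of x] by (simp add: power_mult_distrib)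
      qed
      have qy: "norm (poly q y) \<le> Cq * (1 + K) ^ (n - 1) * norm x ^ (n - 1)"
      proof -
        have "Cq * (1 + norm y) ^ (n - 1) \<le> Cq * ((1 + K) * norm x) ^ (n - 1)"
          using Cq y x T by (intro mult_left_mono power_mono) (auto simp: algebra_simps)
        then show ?thesis using Cq(2)[of y] by (simp add: power_mult_distrib)
      qed
      \<comment> \<open>Passing from \<open>P\<close> to \<open>q\<close> costs nothing because the
        multiples of \<open>p x\<close> and \<open>p y\<close> cancel, and \<open>q\<close> has
        smaller degree.\<close>
      have "poly P y - poly P x = poly q y - poly q x"
        using pxy by (simp add: q_def)
      moreover have "poly P x * (a - b) = (poly P y - poly P x) * b"
        using weights by (simp add: P algebra_simps)
      ultimately have "norm (poly P x) * norm (a - b) = norm (poly q y - poly q x) * norm b"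
        by (metis norm_mult)
      also have "\<dots> \<le> (norm (poly q x) + norm (poly q y)) * norm b"
        using norm_triangle_ineq4[of "poly q y" "poly q x"] by (intro mult_right_mono) auto
      also have "\<dots> \<le> Cq * (2 ^ (n - 1) + (1 + K) ^ (n - 1)) * norm x ^ (n - 1) * norm b"
        using qx qy by (intro mult_right_mono) (auto simp: algebra_simps)
      finally have *: "norm (poly P x) * norm (a - b) \<le>
          Cq * (2 ^ (n - 1) + (1 + K) ^ (n - 1)) * norm x ^ (n - 1) * norm b" .
      have "c2 * norm x ^ n * norm (a - b) \<le> norm (poly P x) * norm (a - b)"
        using c2(3)[of x] x T by (intro mult_right_mono) auto
      also note *
      also have "c2 * norm x ^ n = norm x ^ (n - 1) * (c2 * norm x)"
        using n by (cases n) auto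
      finally have "norm x ^ (n - 1) * (c2 * norm x * norm (a - b)) \<le>
          norm x ^ (n - 1) * (Cq * (2 ^ (n - 1) + (1 + K) ^ (n - 1)) * norm b)"
        by (simp add: mult_ac)
      then have "c2 * norm x * norm (a - b) \<le> Cq * (2 ^ (n - 1) + (1 + K) ^ (n - 1)) * norm b"
        using x T by (subst (asm) mult_le_cancel_left_pos, intro zero_less_power) linarith+
      then have "norm x * norm (a - b) \<le> Cq * (2 ^ (n - 1) + (1 + K) ^ (n - 1)) / c2 * norm b"
        using c2(1) by (simp add: field_simps)
      also have "\<dots> \<le> C * (norm a + norm b)"
        using T by (intro mult_mono) (auto simp: C_def)
      finally show ?thesis .
    qed
  qed
qed

subsection \<open>Growth of entire functions\<close>

text \<open>A Borel-type growth lemma: otherwise iterating the step \<open>r \<mapsto> r * (1 + M r powr (-1/4))\<close> would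
  make \<open>M\<close> unbounded along a bounded sequence of radii.\<close>

lemma slow_growth_radius:
  fixes M :: "real \<Rightarrow> real"
  assumes mono: "\<And>r s. 0 < r \<Longrightarrow> r \<le> s \<Longrightarrow> M r \<le> M s" and r0: "r0 > 0" and M0: "M r0 \<ge> 1"
  shows "\<exists>r\<ge>r0. M (r + r * M r powr (-1/4)) < 16 * M r"
proof (rule ccontr)
  assume "\<not> ?thesis"
  then have grow: "M (r + r * M r powr (-1/4)) \<ge> 16 * M r" if "r \<ge> r0" for r
    using that by (meson not_less)
  define \<rho> where "\<rho> = rec_nat r0 (\<lambda>_ r. r + r * M r powr (-1/4))"
  have \<rho>0: "\<rho> 0 = r0" and \<rho>Suc: "\<rho> (Suc k) = \<rho> k + \<rho> k * M (\<rho> k) powr (-1/4)" for k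
    by (auto simp: \<rho>_def)
  \<comment> \<open>The constants 16 and 1/4 match: \<open>16 ^ k powr (-1/4) = 1 / 2 ^ k\<close> is
    summable, and \<open>2 - 2 / 2 ^ k\<close> is the sum of its first \<open>k\<close> terms. Hence
    the radii stay below \<open>r0 * exp 2\<close>.\<close>
  have inv: "\<rho> k \<ge> r0 \<and> M (\<rho> k) \<ge> 16 ^ k \<and> \<rho> k \<le> r0 * exp (2 - 2 / 2 ^ k)" for k
  proof (induction k)
    case 0
    then show ?case using M0 by (simp add: \<rho>0)
  next
    case (Suc k)
    then have IH: "\<rho> k \<ge> r0" "M (\<rho> k) \<ge> 16 ^ k" "\<rho> k \<le> r0 * exp (2 - 2 / 2 ^ k)" by auto
    have "M (\<rho> k) powr (-1/4) \<le> (16 ^ k) powr (-1/4)"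
      using IH by (intro powr_mono2') auto
    also have "\<dots> = 1 / 2 ^ k"
    proof -
      have "(16 :: real) ^ k = 2 powr (4 * real k)"
        using powr_realpow[of 2 "4 * k"] by (simp add: power_mult)
      then have "((16 :: real) ^ k) powr (-1/4) = 2 powr (- real k)"
        by (simp add: powr_powr)
      then show ?thesis
        by (simp add: powr_minus powr_realpow field_simps)
    qed
    finally have "1 + M (\<rho> k) powr (-1/4) \<le> exp (1 / 2 ^ k)"
      using exp_ge_add_one_self[of "1 / 2 ^ k :: real"] by linarith
    then have "\<rho> k * (1 + M (\<rho> k) powr (-1/4)) \<le> r0 * exp (2 - 2 / 2 ^ k) * exp (1 / 2 ^ k)"
      using IH r0 by (intro mult_mono) auto
    also have "\<dots> = r0 * exp (2 - 2 / 2 ^ Suc k)"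
      by (simp add: mult.assoc flip: exp_add)
    finally have "\<rho> (Suc k) \<le> r0 * exp (2 - 2 / 2 ^ Suc k)"
      by (simp add: \<rho>Suc algebra_simps)
    moreover have "\<rho> (Suc k) \<ge> r0"
      using IH r0 by (simp add: \<rho>Suc add_increasing2)
    moreover have "M (\<rho> (Suc k)) \<ge> 16 ^ Suc k"
      using grow[OF IH(1)] IH(2) by (simp add: \<rho>Suc)
    ultimately show ?case by blast
  qed
  have "16 ^ k \<le> M (r0 * exp 2)" for k
  proof -
    have "r0 * exp (2 - 2 / 2 ^ k) \<le> r0 * exp 2"
      using r0 by simp
    with inv[of k] have "\<rho> k \<le> r0 * exp 2"
      by linarith
    then have "M (\<rho> k) \<le> M (r0 * exp 2)"
      using inv[of k] r0 by (intro mono) auto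
    then show ?thesis using inv[of k] by linarith
  qed
  moreover obtain k where "(16 :: real) ^ k > M (r0 * exp 2)"
    using real_arch_pow[of 16] by auto
  ultimately show False
    by (meson not_less)
qed

text \<open>At a radius of slow growth take \<open>3 * \<delta> = r * M r powr (-1/4)\<close>. Then
  \<open>(r / \<delta>)\<^sup>2\<close> is of order the square root of \<open>M r\<close>, and the
  enlarged radius costs a factor 16 only, so \<open>M r\<close> is bounded by its square root times
  a logarithm. Linear growth makes this impossible.\<close>

lemma log_self_bound_contradiction:
  fixes M :: "real \<Rightarrow> real"
  assumes mono: "\<And>r s. 0 < r \<Longrightarrow> r \<le> s \<Longrightarrow> M r \<le> M s"
    and c: "c > 0" and lin: "\<And>r. r \<ge> r1 \<Longrightarrow> M r \<ge> c * r"
    and bound: "\<And>r \<delta>. r \<ge> r1 \<Longrightarrow> 0 < \<delta> \<Longrightarrow> \<delta> \<le> r \<Longrightarrow>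
      M r \<le> C * (r / \<delta>)\<^sup>2 * (1 + ln r + ln (1 + M (r + 3 * \<delta>) / \<delta>))"
  shows False
proof -
  define C' where "C' = max C 1"
  have C': "C' > 0" "C' \<ge> C" by (auto simp: C'_def)
  \<comment> \<open>The terms for \<open>x = M r\<close>: \<open>9 * x powr (1/2)\<close> is
    \<open>(r / \<delta>)\<^sup>2\<close>, \<open>x / c\<close> bounds \<open>r\<close>, and
    \<open>48 * x\<^sup>2\<close> is the product of \<open>16 * x\<close> for
    \<open>M (r + 3 * \<delta>)\<close> and \<open>3 * x\<close> for
    \<open>1 / \<delta>\<close>.\<close>
  have "eventually (\<lambda>x. 9 * C' * x powr (1/2) * (1 + ln (x / c) + ln (1 + 48 * x\<^sup>2)) < x) at_top"
    using C' c by real_asymp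
  then obtain x0 where x0:
    "\<And>x. x \<ge> x0 \<Longrightarrow> 9 * C' * x powr (1/2) * (1 + ln (x / c) + ln (1 + 48 * x\<^sup>2)) < x"
    unfolding eventually_at_top_linorder by auto
  define r2 where "r2 = Max {r1, 1, x0 / c, 1 / c}"
  have r2: "r2 \<ge> r1" "r2 \<ge> 1" "r2 \<ge> x0 / c" "r2 \<ge> 1 / c"
    by (auto simp: r2_def)
  have big: "M r \<ge> 1" "M r \<ge> x0" "M r \<ge> c * r" if "r \<ge> r2" for r
  proof -
    have "c * r \<ge> x0" "c * r \<ge> 1"
      using r2 that c by (auto simp: pos_divide_le_eq mult.commute intro: order_trans)
    moreover show "M r \<ge> c * r" using that r2 lin by simp
    ultimately show "M r \<ge> 1" "M r \<ge> x0" by linarith+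
  qed
  obtain r where r: "r \<ge> r2" and slow: "M (r + r * M r powr (-1/4)) < 16 * M r"
    using slow_growth_radius[of M r2] mono r2 big(1)[of r2] by auto
  define x where "x = M r"
  have x: "x \<ge> 1" "x \<ge> x0" "x \<ge> c * r" using big[OF r] by (auto simp: x_def)
  have r1: "r \<ge> 1" "r > 0" using r r2 by auto
  define \<delta> where "\<delta> = r * x powr (-1/4) / 3"
  have px: "x powr (-1/4) > 0" "x powr (-1/4) \<le> 1"
    using x powr_mono[of "-1/4" 0 x] by auto
  have \<delta>: "\<delta> > 0" "\<delta> \<le> r"
    using r1 px mult_left_mono[of "x powr (-1/4)" 1 r] by (auto simp: \<delta>_def)
  have q: "(r / \<delta>)\<^sup>2 = 9 * x powr (1/2)"
  proof -
    have "r / \<delta> = 3 * x powr (1/4)"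
      using r1 x by (simp add: \<delta>_def powr_minus field_simps)
    moreover have "(x powr (1/4))\<^sup>2 = x powr (1/2)"
      using x by (simp add: power2_eq_square flip: powr_add)
    ultimately show ?thesis by (simp add: power_mult_distrib)
  qed
  have Md: "M (r + 3 * \<delta>) \<le> 16 * x" "M (r + 3 * \<delta>) \<ge> 1"
    using slow \<delta> r1 big(1)[of "r + 3 * \<delta>"] r by (auto simp: \<delta>_def x_def)
  have "1 / \<delta> = 3 * x powr (1/4) / r"
    using r1 x by (simp add: \<delta>_def powr_minus field_simps)
  also have "\<dots> \<le> 3 * x powr 1 / 1"
    using r1 x by (intro frac_le mult_left_mono powr_mono) auto
  finally have inv\<delta>: "1 / \<delta> \<le> 3 * x" using x by simp
  have "M (r + 3 * \<delta>) * (1 / \<delta>) \<le> (16 * x) * (3 * x)"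
    using Md inv\<delta> \<delta> x by (intro mult_mono) auto
  then have "1 + M (r + 3 * \<delta>) / \<delta> \<le> 1 + 48 * x\<^sup>2"
    by (simp add: power2_eq_square)
  then have l1: "ln (1 + M (r + 3 * \<delta>) / \<delta>) \<le> ln (1 + 48 * x\<^sup>2)"
    using Md \<delta> by (intro ln_mono) (auto intro!: add_pos_nonneg divide_nonneg_pos)
  have l2: "ln r \<le> ln (x / c)"
    using x c r1 by (intro ln_mono) (auto simp: field_simps)
  have pos: "0 \<le> 1 + ln r + ln (1 + M (r + 3 * \<delta>) / \<delta>)"
    using r1 Md \<delta> by (intro add_nonneg_nonneg ln_ge_zero) auto
  have "x \<le> C * (r / \<delta>)\<^sup>2 * (1 + ln r + ln (1 + M (r + 3 * \<delta>) / \<delta>))"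
    unfolding x_def using r r2 \<delta> by (intro bound) auto
  also have "\<dots> \<le> C' * (r / \<delta>)\<^sup>2 * (1 + ln (x / c) + ln (1 + 48 * x\<^sup>2))"
    using l1 l2 pos C' by (intro mult_mono) auto
  also have "\<dots> < x"
    using x0[OF x(2)] by (simp add: q mult_ac)
  finally show False by simp
qed

text \<open>The quotient estimate bounds \<open>Re g\<close> by the logarithm of
  \<open>deriv g\<close>. Borel-Caratheodory passes from \<open>Re g\<close> to
  \<open>norm g\<close> and Cauchy's inequality from \<open>deriv g\<close> back to
  \<open>g\<close>, so the maximum modulus of a nonconstant \<open>g\<close> would satisfy the
  impossible self-bound.\<close>

lemma entire_exponent_constant:
  fixes D g :: "complex \<Rightarrow> complex"
  assumes D: "D holomorphic_on UNIV" and g: "g holomorphic_on UNIV" and D0: "D 0 \<noteq> 0"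
    and bD: "\<And>z. norm z \<ge> T \<Longrightarrow>
      norm (D z) \<le> C * norm z ^ N * (1 + norm (deriv g z) + norm (deriv g (- z)))"
    and bK: "\<And>z. norm z \<ge> T \<Longrightarrow>
      norm (exp (g z) * D z) \<le> C * norm z ^ N * (1 + norm (deriv g z) + norm (deriv g (- z)))"
  shows "g constant_on UNIV"
proof (rule ccontr)
  assume nonconst: "\<not> g constant_on UNIV"
  define M where "M r = (SUP z\<in>cball 0 r. norm (g z))" for r
  have cont: "continuous_on A g" for A
    by (rule holomorphic_on_imp_continuous_on[OF holomorphic_on_subset[OF g]]) auto
  have bdd: "bdd_above ((\<lambda>z. norm (g z)) ` cball 0 r)" for r
    by (intro bounded_imp_bdd_above compact_imp_bounded compact_continuous_image
          continuous_intros cont) auto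
  have g_le: "norm (g z) \<le> M r" if "norm z \<le> r" for z r
    unfolding M_def using bdd that by (intro cSUP_upper) auto
  have M_le: "M r \<le> B" if "\<And>z. norm z \<le> r \<Longrightarrow> norm (g z) \<le> B" "r \<ge> 0" for r B
    unfolding M_def using that by (intro cSUP_least) auto
  have mono: "M r \<le> M s" if "0 < r" "r \<le> s" for r s
    using that by (intro M_le g_le) auto
  have M_nonneg: "M r \<ge> 0" if "r > 0" for r
    using order_trans[OF norm_ge_zero g_le[of 0 r]] that by simp
  have deriv_le: "norm (deriv g z) \<le> M (norm z + \<delta>) / \<delta>" if "\<delta> > 0" for z \<delta>
  proof -
    have "norm (g w) \<le> M (norm z + \<delta>)" if "norm (z - w) = \<delta>" for w
      using that norm_triangle_ineq4[of z "z - w"] by (intro g_le) auto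
    then show ?thesis
      using Cauchy_inequality[of g z \<delta> "M (norm z + \<delta>)" 1] that cont holomorphic_on_subset[OF g]
      by simp
  qed

  obtain w where w: "deriv g w \<noteq> 0"
  proof -
    have "\<exists>c. \<forall>x\<in>UNIV. g x = c" if "\<And>z. deriv g z = 0"
      using that holomorphic_derivI[OF g open_UNIV, of _ UNIV]
      by (intro has_field_derivative_zero_constant) auto
    then show thesis
      using nonconst that by (auto simp: constant_on_def)
  qed
  \<comment> \<open>Cauchy's inequality at \<open>w\<close> with radius \<open>r / 2\<close>: a
    nonzero derivative forces linear growth.\<close>
  have lin: "norm (deriv g w) / 2 * r \<le> M r" if "r \<ge> max 1 (2 * norm w)" for r
  proof -
    have r: "r / 2 > 0" "norm w + r / 2 \<le> r" using that by auto
    have "norm (deriv g w) \<le> M (norm w + r / 2) / (r / 2)"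
      by (rule deriv_le) (use r in auto)
    also have "\<dots> \<le> M r / (r / 2)"
      using r by (intro divide_right_mono mono add_nonneg_pos) auto
    finally show ?thesis using r by (simp add: field_simps)
  qed

  \<comment> \<open>The factor 2 absorbs the two derivative terms, and \<open>ln 3\<close> comes
    from \<open>R \<le> 3 * r\<close>.\<close>
  define C1 where "C1 = max 1 (2 * C)"
  define L0 where "L0 = \<bar>ln (norm (D 0))\<bar> + ln C1 + real N * ln 3"
  define C2 where "C2 = 3 * norm (g 0) + 12 * (L0 + real N + 1)"
  have C1: "C1 \<ge> 1" "2 * C \<le> C1" by (auto simp: C1_def)
  have L0: "L0 \<ge> 0" using C1 by (simp add: L0_def)
  have bound: "M r \<le> C2 * (r / \<delta>)\<^sup>2 * (1 + ln r + ln (1 + M (r + 3 * \<delta>) / \<delta>))"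
    if r: "r \<ge> max 1 T" and \<delta>: "0 < \<delta>" "\<delta> \<le> r" for r \<delta>
  proof -
    \<comment> \<open>Four radii with gaps \<open>\<delta>\<close>: \<open>g\<close> is bounded up
      to \<open>r\<close>, \<open>Re g\<close> below \<open>r + \<delta>\<close>, the hypotheses are
      applied on the circle of radius \<open>R = r + 2 * \<delta>\<close>, and Cauchy's inequality
      there reaches \<open>r + 3 * \<delta>\<close>.\<close>
    define R where "R = r + 2 * \<delta>"
    define X where "X = 1 + M (r + 3 * \<delta>) / \<delta>"
    define B where "B = C1 * R ^ N * X"
    define L where "L = L0 + real N * ln r + ln X"
    have R: "R \<ge> 1" "R \<ge> T" "R \<le> 3 * r" "R > 0" "r > 0" "R \<ge> r"
      using r \<delta> by (auto simp: R_def)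
    have X: "X \<ge> 1"
      using M_nonneg[of "r + 3 * \<delta>"] r \<delta> by (simp add: X_def)
    have B: "B > 0" using C1 R X by (simp add: B_def)
    have gder: "norm (deriv g z) \<le> X - 1" if "norm z = R" for z
      using deriv_le[OF \<delta>(1), of z] that by (simp add: X_def R_def add.commute add.left_commute)
    have le_B: "C * norm z ^ N * (1 + norm (deriv g z) + norm (deriv g (- z))) \<le> B"
      if z: "norm z = R" for z
    proof -
      have "C * (1 + norm (deriv g z) + norm (deriv g (- z))) \<le> C1 * X"
      proof -
        have "C * (1 + norm (deriv g z) + norm (deriv g (- z))) \<le>
            (C1 / 2) * (1 + norm (deriv g z) + norm (deriv g (- z)))"
          using C1 by (intro mult_right_mono) auto
        also have "\<dots> \<le> (C1 / 2) * (2 * X)"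
          using gder[of z] gder[of "- z"] z C1 by (intro mult_left_mono) auto
        finally show ?thesis by simp
      qed
      then have "R ^ N * (C * (1 + norm (deriv g z) + norm (deriv g (- z)))) \<le> R ^ N * (C1 * X)"
        using R by (intro mult_left_mono) auto
      then show ?thesis
        using z by (simp add: B_def mult_ac)
    qed
    have lnB: "ln B - ln (norm (D 0)) \<le> L"
    proof -
      have "ln B = ln C1 + real N * ln R + ln X"
        using C1 R X by (simp add: B_def ln_mult ln_realpow)
      moreover have "ln R \<le> ln 3 + ln r"
        using R ln_mono[of R "3 * r"] by (simp add: ln_mult)
      then have "real N * ln R \<le> real N * ln 3 + real N * ln r"
        by (simp flip: distrib_left add: mult_left_mono)
      ultimately show ?thesis
        by (simp add: L_def L0_def)
    qed
    have lnr: "ln r \<ge> 0" "ln X \<ge> 0" using r X by auto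
    have L: "L \<ge> 0" using L0 lnr by (simp add: L_def)
    \<comment> \<open>The factor 6 arises as \<open>R + norm z \<le> 6 * r\<close> over
      \<open>R - norm z \<ge> \<delta>\<close>.\<close>
    have Re_g: "Re (g z) \<le> 6 * (r / \<delta>) * L" if z: "norm z < r + \<delta>" for z
    proof -
      have "Re (g z) \<le> (R + norm z) / (R - norm z) * (ln B - ln (norm (D 0)))"
      proof (rule Re_le_of_bounded_quotient[OF D g D0])
        show "norm (D u) \<le> B" if "norm u = R" for u
          using bD[of u] le_B[OF that] that R by linarith
        show "norm (exp (g u) * D u) \<le> B" if "norm u = R" for u
          using bK[of u] le_B[OF that] that R by linarith
      qed (use z \<delta> in \<open>simp add: R_def\<close>)
      also have "\<dots> \<le> (R + norm z) / (R - norm z) * L"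
        using lnB z \<delta> R by (intro mult_left_mono) (auto simp: R_def)
      also have "(R + norm z) / (R - norm z) \<le> (6 * r) / \<delta>"
        using z \<delta> R by (intro frac_le) (auto simp: R_def)
      then have "(R + norm z) / (R - norm z) * L \<le> 6 * r / \<delta> * L"
        using L by (intro mult_right_mono)
      finally show ?thesis by simp
    qed
    define t where "t = r / \<delta>"
    have t: "t \<ge> 1" using \<delta> by (simp add: t_def)
    have "norm (g z) \<le> t\<^sup>2 * (3 * norm (g 0) + 12 * L)" if z: "norm z \<le> r" for z
    proof -
      have "norm (g z - g 0) \<le>
          2 * norm z / (r + \<delta> - norm z) * (6 * (r / \<delta>) * L - Re (g 0))"
        by (rule Borel_Caratheodory[OF _ Re_g]) (use z \<delta> holomorphic_on_subset[OF g] in auto)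
      also have "\<dots> \<le> 2 * r / \<delta> * (6 * (r / \<delta>) * L + norm (g 0))"
      proof (rule mult_mono)
        show "2 * norm z / (r + \<delta> - norm z) \<le> 2 * r / \<delta>"
          using z \<delta> by (intro frac_le) auto
        show "6 * (r / \<delta>) * L - Re (g 0) \<le> 6 * (r / \<delta>) * L + norm (g 0)"
          using abs_Re_le_cmod[of "g 0"] by linarith
        show "0 \<le> 6 * (r / \<delta>) * L - Re (g 0)"
          using Re_g[of 0] \<delta> R by simp
      qed (use R \<delta> in auto)
      also have "\<dots> = 12 * t\<^sup>2 * L + 2 * t * norm (g 0)"
        by (simp add: t_def power2_eq_square algebra_simps)
      also have "\<dots> \<le> 12 * t\<^sup>2 * L + 2 * t\<^sup>2 * norm (g 0)"
        using t by (intro add_left_mono mult_right_mono mult_left_mono self_le_power) auto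
      finally have "norm (g z) \<le> norm (g 0) + 12 * t\<^sup>2 * L + 2 * t\<^sup>2 * norm (g 0)"
        using norm_triangle_sub[of "g z" "g 0"] by linarith
      moreover have "norm (g 0) \<le> t\<^sup>2 * norm (g 0)"
        using t one_le_power[of t 2] mult_right_mono[of 1 "t\<^sup>2" "norm (g 0)"] by simp
      ultimately show ?thesis by (simp add: algebra_simps)
    qed
    then have "M r \<le> t\<^sup>2 * (3 * norm (g 0) + 12 * L)"
      using R by (intro M_le) auto
    also have "3 * norm (g 0) + 12 * L \<le> C2 * (1 + ln r + ln X)"
    proof -
      have "L \<le> (L0 + real N + 1) * (1 + ln r + ln X)"
        using lnr L0 by (simp add: L_def algebra_simps)
      moreover have "norm (g 0) * 1 \<le> norm (g 0) * (1 + ln r + ln X)"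
        using lnr by (intro mult_left_mono) auto
      ultimately show ?thesis
        by (simp add: C2_def algebra_simps)
    qed
    then have "t\<^sup>2 * (3 * norm (g 0) + 12 * L) \<le> t\<^sup>2 * (C2 * (1 + ln r + ln X))"
      by (intro mult_left_mono) auto
    finally show ?thesis
      by (simp add: t_def X_def mult_ac)
  qed
  show False
  proof (rule log_self_bound_contradiction)
    show "norm (deriv g w) / 2 > 0" using w by simp
    show "norm (deriv g w) / 2 * r \<le> M r" if "r \<ge> max (max 1 T) (2 * norm w)" for r
      using lin that by auto
    show "M r \<le> C2 * (r / \<delta>)\<^sup>2 * (1 + ln r + ln (1 + M (r + 3 * \<delta>) / \<delta>))"
      if "r \<ge> max (max 1 T) (2 * norm w)" "0 < \<delta>" "\<delta> \<le> r" for r \<delta>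
      using bound that by auto
  qed (use mono in auto)
qed

subsection \<open>Even and odd compositions\<close>

text \<open>Part (A) is the contrapositive of this; part (B) applies it to
  \<open>p ^ 2\<close>.\<close>

lemma poly_comp_even_imp:
  fixes f :: "complex \<Rightarrow> complex"
  assumes f: "transcendental_entire f" and fin: "finite {z. f z = 0}" and p: "degree p > 0"
    and even: "even_function (poly p \<circ> f)"
  shows "even_function f \<or> odd_function f"
proof -
  have holf: "f holomorphic_on UNIV" and not_poly: "\<And>q. f \<noteq> poly q"
    using f by (auto simp: transcendental_entire_def entire_def)

  \<comment> \<open>Factorization of \<open>f\<close> as a polynomial times an exponential\<close>
  obtain w0 where w0: "f w0 \<noteq> 0"
    using not_poly[of 0] by (metis poly_0 ext)
  define Z where "Z = {z. f z = 0}"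
  obtain m h where h: "h holomorphic_on UNIV" "\<forall>a\<in>Z. h a \<noteq> 0"
    "\<And>z. f z = (\<Prod>a\<in>Z. (z - a) ^ m a) * h z"
    using entire_factor_finite[OF holf w0 fin] unfolding Z_def by metis
  have "h z \<noteq> 0" for z
  proof
    assume "h z = 0"
    then have "f z = 0" by (simp add: h(3))
    then have "z \<in> Z" by (simp add: Z_def)
    then show False using h(2) \<open>h z = 0\<close> by blast
  qed
  then obtain g where g: "g holomorphic_on UNIV" "\<And>z. h z = exp (g z)"
    using contractible_imp_holomorphic_log[OF h(1)]
    by (metis UNIV_I convex_UNIV convex_imp_contractible)
  define R where "R = (\<Prod>a\<in>Z. [:- a, 1:] ^ m a)"
  have f_eq: "f z = poly R z * exp (g z)" for z
    by (simp add: h(3) R_def poly_prod g(2))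
  have "R \<noteq> 0" using f_eq[of w0] w0 by auto
  have g_nonconst: "\<not> g constant_on UNIV"
  proof
    assume "g constant_on UNIV"
    then obtain c where "\<And>z. g z = c" by (auto simp: constant_on_def)
    then have "f = poly (smult (exp c) R)"
      using f_eq by (auto simp: fun_eq_iff)
    then show False using not_poly by blast
  qed

  \<comment> \<open>\<open>\<alpha> z\<close> is the logarithmic derivative of \<open>f\<close>
    multiplied by \<open>R z * R (- z)\<close> to clear denominators. Likewise
    \<open>- \<alpha> (- z)\<close> comes from \<open>f (- z)\<close>, so \<open>D\<close> is the
    cleared difference of the two.\<close>
  define \<alpha> where "\<alpha> z = poly R (- z) * (poly (pderiv R) z + poly R z * deriv g z)" for z
  define D where "D z = \<alpha> z + \<alpha> (- z)" for z
  have g': "(g has_field_derivative deriv g z) (at z)" for z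
    using holomorphic_derivI[OF g(1), of z UNIV] by simp
  have f': "(f has_field_derivative (poly (pderiv R) z + poly R z * deriv g z) * exp (g z)) (at z)" for z
  proof -
    have "((\<lambda>z. poly R z * exp (g z)) has_field_derivative
        (poly (pderiv R) z + poly R z * deriv g z) * exp (g z)) (at z)"
      by (auto intro!: derivative_eq_intros g' simp: algebra_simps)
    then show ?thesis by (simp add: f_eq[abs_def])
  qed
  have f'': "(f has_field_derivative deriv f z) (at z)" for z
    using holomorphic_derivI[OF holf, of z UNIV] by simp
  have deriv_f: "deriv f z = (poly (pderiv R) z + poly R z * deriv g z) * exp (g z)" for z
    using f' by (rule DERIV_imp_deriv)
  have fm': "((\<lambda>z. f (- z)) has_field_derivative - deriv f (- z)) (at z)" for z
    using DERIV_chain2[OF f'' DERIV_minus[OF DERIV_ident], of z] by simp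

  \<comment> \<open>Differentiating the evenness of the composition\<close>
  have pf: "poly p (f z) = poly p (f (- z))" for z
    using even by (simp add: even_function_def)
  have dpf: "poly (pderiv p) (f z) * deriv f z = - (poly (pderiv p) (f (- z)) * deriv f (- z))" for z
  proof -
    have "((\<lambda>z. poly p (f z)) has_field_derivative poly (pderiv p) (f z) * deriv f z) (at z)"
      by (rule DERIV_chain2[OF poly_DERIV f''])
    moreover have "((\<lambda>z. poly p (f (- z))) has_field_derivative
        poly (pderiv p) (f (- z)) * - deriv f (- z)) (at z)"
      by (rule DERIV_chain2[OF poly_DERIV fm'])
    moreover have "(\<lambda>z. poly p (f (- z))) = (\<lambda>z. poly p (f z))"
      by (rule ext) (rule pf[symmetric])
    ultimately have "poly (pderiv p) (f z) * deriv f z = poly (pderiv p) (f (- z)) * - deriv f (- z)"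
      by (metis DERIV_unique)
    then show ?thesis by simp
  qed

  have alpha_hol: "\<alpha> holomorphic_on UNIV"
    unfolding \<alpha>_def by (intro holomorphic_intros holomorphic_deriv g) auto
  then have D_hol: "D holomorphic_on UNIV"
    unfolding D_def
    by (intro holomorphic_intros holomorphic_on_compose_gen[OF _ alpha_hol, unfolded o_def]) auto

  \<comment> \<open>Vanishing of the difference of logarithmic derivatives\<close>
  have "D z = 0" for z
  proof (rule ccontr)
    assume "D z \<noteq> 0"
    \<comment> \<open>The growth argument needs a nonzero value at the origin; dividing by
      \<open>z ^ k\<close> does not increase the modulus where
      \<open>norm z \<ge> 1\<close>.\<close>
    then obtain k D1 where D1: "D1 holomorphic_on UNIV" "D1 0 \<noteq> 0" "\<And>z. D z = (z - 0) ^ k * D1 z"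
      using entire_factor_at[OF D_hol] by metis
    obtain C where C: "C > 0"
      "\<And>x y a b. poly p x = poly p y \<Longrightarrow> x * poly (pderiv p) x * a = y * poly (pderiv p) y * b \<Longrightarrow>
         norm x * norm (a - b) \<le> C * (norm a + norm b)"
      using poly_eq_imp_weights_close[OF p] by metis
    define d where "d = degree R"
    obtain A where A: "A > 0" "\<And>x. norm (poly R x) \<le> A * (1 + norm x) ^ d"
      using poly_norm_upper_bound[of R d] d_def by auto
    obtain A' where A': "A' > 0" "\<And>x. norm (poly (pderiv R) x) \<le> A' * (1 + norm x) ^ d"
      using poly_norm_upper_bound[of "pderiv R" d] d_def by (auto simp: degree_pderiv)
    obtain c T where c: "c > 0" "T \<ge> 1" "\<And>x. norm x \<ge> T \<Longrightarrow> norm (poly R x) \<ge> c * norm x ^ d"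
      using poly_norm_lower_bound[OF \<open>R \<noteq> 0\<close>] d_def by metis
    define B where "B = A * (A' + A) * 2 ^ (2 * d)"
    have B: "B > 0" using A A' by (simp add: B_def)
    have alpha_le: "norm (\<alpha> z) \<le> B * norm z ^ (2 * d) * (1 + norm (deriv g z))" if z: "norm z \<ge> 1" for z
    proof -
      define s where "s = (1 + norm z) ^ d"
      have s: "s \<ge> 0" by (simp add: s_def)
      have "norm (poly (pderiv R) z + poly R z * deriv g z) \<le> A' * s + A * s * norm (deriv g z)"
        unfolding s_def using A A'
        by (intro order_trans[OF norm_triangle_ineq] add_mono) (auto simp: norm_mult intro!: mult_right_mono)
      also have "\<dots> \<le> (A' + A) * s * (1 + norm (deriv g z))"
        using A A' s by (simp add: algebra_simps)
      finally have "norm (\<alpha> z) \<le> A * s * ((A' + A) * s * (1 + norm (deriv g z)))"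
        unfolding \<alpha>_def norm_mult using A(2)[of "- z"] A s by (intro mult_mono) (auto simp: s_def)
      also have "\<dots> = A * (A' + A) * (1 + norm z) ^ (2 * d) * (1 + norm (deriv g z))"
        by (simp add: s_def power_mult power2_eq_square power_mult_distrib mult_ac flip: power_mult_distrib)
      also have "\<dots> \<le> A * (A' + A) * (2 * norm z) ^ (2 * d) * (1 + norm (deriv g z))"
        using z A A' by (intro mult_right_mono mult_left_mono power_mono) auto
      finally show ?thesis
        by (simp add: B_def power_mult_distrib mult_ac)
    qed
    have sum_le: "norm (\<alpha> z) + norm (\<alpha> (- z)) \<le>
        2 * B * norm z ^ (2 * d) * (1 + norm (deriv g z) + norm (deriv g (- z)))"
      if z: "norm z \<ge> 1" for z
    proof -
      have "norm (\<alpha> z) + norm (\<alpha> (- z)) \<le>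
          B * norm z ^ (2 * d) * (1 + norm (deriv g z)) + B * norm z ^ (2 * d) * (1 + norm (deriv g (- z)))"
        using alpha_le[of z] alpha_le[of "- z"] z by simp
      also have "\<dots> = B * norm z ^ (2 * d) * (2 + norm (deriv g z) + norm (deriv g (- z)))"
        by (simp add: algebra_simps)
      also have "\<dots> \<le> B * norm z ^ (2 * d) * (2 * (1 + norm (deriv g z) + norm (deriv g (- z))))"
        using B by (intro mult_left_mono) auto
      finally show ?thesis by (simp only: mult_ac)
    qed
    have D1_le: "norm (D1 z) \<le> norm (D z)" if "norm z \<ge> 1" for z
      using that mult_right_mono[of 1 "norm z ^ k" "norm (D1 z)"]
      by (simp add: D1(3) norm_mult norm_power one_le_power)
    \<comment> \<open>The weights estimate with \<open>x = f z\<close>, \<open>y = f (- z)\<close>,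
      \<open>a = \<alpha> z\<close>, \<open>b = - \<alpha> (- z)\<close>; its second hypothesis is
      \<open>dpf\<close> times \<open>R z * R (- z)\<close>.\<close>
    have fD: "norm (f z) * norm (D z) \<le> C * (norm (\<alpha> z) + norm (\<alpha> (- z)))" for z
    proof -
      have alpha_f: "\<alpha> z * f z = poly R z * poly R (- z) * deriv f z" for z
        by (simp add: \<alpha>_def f_eq deriv_f)
      have "f z * poly (pderiv p) (f z) * \<alpha> z = f (- z) * poly (pderiv p) (f (- z)) * - \<alpha> (- z)"
      proof -
        have "f z * poly (pderiv p) (f z) * \<alpha> z =
            poly R z * poly R (- z) * (poly (pderiv p) (f z) * deriv f z)"
          using alpha_f[of z] by (simp add: mult_ac)
        also have "\<dots> = - (poly (pderiv p) (f (- z)) * (poly R (- z) * poly R z * deriv f (- z)))"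
          by (simp only: dpf[of z]) (simp add: mult_ac)
        also have "poly R (- z) * poly R z * deriv f (- z) = \<alpha> (- z) * f (- z)"
          using alpha_f[of "- z"] by simp
        finally show ?thesis by (simp add: mult_ac)
      qed
      then show ?thesis
        using C(2)[OF pf[of z]] by (fastforce simp: D_def)
    qed
    \<comment> \<open>One constant for both bounds: \<open>2 * B\<close> for \<open>D1\<close> and
      \<open>C / c * (2 * B)\<close> for \<open>exp g * D1\<close>, where \<open>1 / c\<close> is
      the price of removing \<open>R\<close> from \<open>f\<close>.\<close>
    define C' where "C' = max 1 (C / c) * (2 * B)"
    have C': "2 * B \<le> C'" "C / c * (2 * B) \<le> C'"
      using B mult_right_mono[of 1 "max 1 (C / c)" "2 * B"]
        mult_right_mono[of "C / c" "max 1 (C / c)" "2 * B"]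
      by (auto simp: C'_def)
    have "g constant_on UNIV"
    proof (rule entire_exponent_constant[OF D1(1) g(1) D1(2), of T C' "2 * d"])
      fix z :: complex assume z: "norm z \<ge> T"
      then have z1: "norm z \<ge> 1" using c by linarith
      let ?X = "norm z ^ (2 * d) * (1 + norm (deriv g z) + norm (deriv g (- z)))"
      have X: "?X \<ge> 0" by simp
      have sum_le': "norm (\<alpha> z) + norm (\<alpha> (- z)) \<le> 2 * B * ?X"
        using sum_le[OF z1] by (simp add: mult.assoc)
      have "norm (D1 z) \<le> norm (\<alpha> z) + norm (\<alpha> (- z))"
        using D1_le[OF z1] norm_triangle_ineq[of "\<alpha> z" "\<alpha> (- z)"] by (simp add: D_def)
      also note sum_le'
      also have "2 * B * ?X \<le> C' * ?X"
        using C' X by (intro mult_right_mono) auto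
      finally show "norm (D1 z) \<le> C' * norm z ^ (2 * d) * (1 + norm (deriv g z) + norm (deriv g (- z)))"
        by (simp only: mult.assoc)
      have "c * 1 \<le> c * norm z ^ d"
        using c z1 by (intro mult_left_mono one_le_power) auto
      then have Rz: "c \<le> norm (poly R z)"
        using c(3)[OF z] by linarith
      have "c * norm (exp (g z) * D1 z) \<le> norm (poly R z) * norm (exp (g z) * D z)"
        using Rz c D1_le[OF z1] by (intro mult_mono) (auto simp: norm_mult intro!: mult_left_mono)
      also have "\<dots> = norm (f z) * norm (D z)"
        by (simp add: f_eq norm_mult mult_ac)
      also have "\<dots> \<le> C * (2 * B * ?X)"
        using sum_le' C(1) by (intro order_trans[OF fD] mult_left_mono) auto
      finally have "norm (exp (g z) * D1 z) \<le> C / c * (2 * B) * ?X"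
        using c by (simp add: field_simps)
      also have "\<dots> \<le> C' * ?X"
        using C' X by (intro mult_right_mono) auto
      finally show "norm (exp (g z) * D1 z) \<le>
          C' * norm z ^ (2 * d) * (1 + norm (deriv g z) + norm (deriv g (- z)))"
        by (simp only: mult.assoc)
    qed
    then show False using g_nonconst by simp
  qed

  \<comment> \<open>Proportionality of \<open>f (- z)\<close> and \<open>f z\<close>\<close>
  have wronskian: "f (- z) * deriv f z + f z * deriv f (- z) = 0" for z
  proof -
    have "f (- z) * deriv f z + f z * deriv f (- z) = exp (g z) * exp (g (- z)) * D z"
      by (simp add: f_eq deriv_f D_def \<alpha>_def algebra_simps)
    then show ?thesis using \<open>D z = 0\<close> by simp
  qed
  have "open {z. f z \<noteq> 0}"
    using holomorphic_on_imp_continuous_on[OF holf]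
    by (intro open_Collect_neq continuous_on_const)
  then obtain r where r: "r > 0" "ball w0 r \<subseteq> {z. f z \<noteq> 0}"
    using w0 openE by blast
  \<comment> \<open>The Wronskian is, up to sign, the numerator of the derivative of this quotient.
    Near \<open>w0\<close> the denominator is nonzero; the identity theorem then extends the
    relation to the plane.\<close>
  have "\<exists>c. \<forall>z\<in>ball w0 r. f (- z) / f z = c"
  proof (rule has_field_derivative_zero_constant)
    fix z assume "z \<in> ball w0 r"
    then have "f z \<noteq> 0" using r by auto
    then have "((\<lambda>z. f (- z) / f z) has_field_derivative
        (- deriv f (- z) * f z - f (- z) * deriv f z) / (f z * f z)) (at z)"
      by (intro DERIV_divide fm' f'')
    moreover have "- deriv f (- z) * f z - f (- z) * deriv f z = 0"
      using wronskian[of z] by (simp add: algebra_simps add_eq_0_iff)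
    ultimately show "((\<lambda>z. f (- z) / f z) has_field_derivative 0) (at z within ball w0 r)"
      using has_field_derivative_at_within by fastforce
  qed simp
  then obtain c where c: "\<And>z. z \<in> ball w0 r \<Longrightarrow> f (- z) / f z = c"
    by auto
  have cf: "f (- z) = c * f z" for z
  proof (rule analytic_continuation_open[of "ball w0 r" UNIV "\<lambda>z. f (- z)" "\<lambda>z. c * f z"])
    show "(\<lambda>z. f (- z)) holomorphic_on UNIV"
      by (intro holomorphic_on_compose_gen[OF _ holf, unfolded o_def] holomorphic_intros) auto
    show "f (- z) = c * f z" if "z \<in> ball w0 r" for z
      using c[OF that] r that by (auto simp: field_simps)
  qed (use r holf in \<open>auto intro!: holomorphic_intros\<close>)
  \<comment> \<open>Reflecting twice returns to the same point.\<close>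
  have "f w0 = c * (c * f w0)"
    using cf[of w0] cf[of "- w0"] by simp
  then have "c * c = 1" using w0 by simp
  then have "c = 1 \<or> c = -1" by (simp add: square_eq_1_iff)
  then show ?thesis
    using cf by (auto simp: even_function_def odd_function_def)
qed

theorem theorem10:
  fixes f :: "complex \<Rightarrow> complex" and p :: "complex poly"
  assumes "transcendental_entire f"
    and "finite {z. f z = 0}"
    and "degree p > 0"
  shows "(\<not> even_function f \<and> \<not> odd_function f \<longrightarrow> \<not> even_function (poly p \<circ> f)) \<and>
         (\<not> odd_function f \<longrightarrow> \<not> odd_function (poly p \<circ> f))"
proof (intro conjI impI)
  assume "\<not> even_function f \<and> \<not> odd_function f"
  then show "\<not> even_function (poly p \<circ> f)"
    using poly_comp_even_imp[OF assms] by blast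
next
  assume not_odd: "\<not> odd_function f"
  show "\<not> odd_function (poly p \<circ> f)"
  proof
    assume odd: "odd_function (poly p \<circ> f)"
    \<comment> \<open>The square of an odd function is even.\<close>
    then have "even_function (poly (p ^ 2) \<circ> f)"
      by (simp add: odd_function_def even_function_def)
    moreover have "degree (p ^ 2) > 0"
      using assms(3) by (subst degree_power_eq) auto
    ultimately have "even_function f"
      using poly_comp_even_imp[OF assms(1,2)] not_odd by blast
    \<comment> \<open>For even \<open>f\<close> the composition is both even and odd, hence zero. So
      \<open>f\<close> maps into the finite root set of \<open>p\<close>, and continuity makes it
      constant.\<close>
    then have "poly p (f z) = 0" for z
      using odd by (auto simp: odd_function_def even_function_def dest!: spec[of _ z])
    then have "range f \<subseteq> {x. poly p x = 0}"
      by auto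
    then have "finite (range f)"
      using assms(3) by (metis degree_0 finite_subset less_irrefl poly_roots_finite)
    have "continuous_on UNIV f"
      using assms(1) by (auto simp: transcendental_entire_def entire_def
          intro: holomorphic_on_imp_continuous_on)
    then have "f constant_on UNIV"
      using \<open>finite (range f)\<close> by (intro continuous_finite_range_constant) auto
    then obtain c where "\<And>z. f z = c"
      by (auto simp: constant_on_def)
    then have "f = poly [:c:]" by auto
    then show False
      using assms(1) by (auto simp: transcendental_entire_def)
  qed
qed

end
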